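(* Let $n=1$. For every integer $w>2$ and every $k\in\{0,1,2,3\}$, the rank of the boundary operator $\partial: C_{w+k+1,\,w,\,-w}\to C_{w+k,\,w,\,-w}$ is equal to the rank of the boundary operator $\partial: C_{2+k+1,\,2,\,-2}\to C_{2+k,\,2,\,-2}$, where $C_{m,w,h}$ are the doubly weighted chain spaces of the Lie superalgebra $\mathfrak g$ of polynomial vector fields and polynomial differential forms on $\mathbb R$.
   Context: Lie superalgebra: On the line $\mathbb R$ with coordinate $x$, for integers $j\ge 0$ put $\mathfrak g(0)_j=\mathbb R\,x^j\frac{d}{dx}$ (vector fields), $\mathfrak g(1)_j=\mathbb R\,x^j$ (functions, i.e. 0-forms), $\mathfrak g(2)_j=\mathbb R\,x^j\,dx$ (1-forms), and $\mathfrak g=\bigoplus_{i\in\{0,1,2\},\,j\ge 0}\mathfrak g(i)_j$. An element of $\mathfrak g(i)_j$ has degree $i$ and parity $i \bmod 2$. The super bracket is: $[X,Y]$ the usual Lie bracket of vector fields; $[X,\alpha]=L_X\alpha=-[\alpha,X]$ (Lie derivative) for a vector field $X$ and a form $\alpha$; and $[\alpha,\beta]=(-1)^a d(\alpha\wedge\beta)$ for an $a$-form $\alpha$ and a form $\beta$ (so $[f,g]=d(fg)$ for functions, and the bracket of a 1-form with any form is $0$). Chains: The $m$-th chain space ($m\ge1$) is the space spanned by the products $A_1\bigtriangleup\cdots\bigtriangleup A_m$ of elements of $\mathfrak g$, where $\bigtriangleup$ is the associative multilinear product subject to $A\bigtriangleup A'+(-1)^{ii'}A'\bigtriangleup A=0$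 for $A$ of degree $i$ and $A'$ of degree $i'$ (skew-symmetric unless both factors are functions, symmetric between functions). The boundary operator is $$\partial(A_1\bigtriangleup\cdots\bigtriangleup A_m)=\sum_{i<j}(-1)^{\,i-1+a_i\sum_{i<s<j}a_s}\,A_1\bigtriangleup\cdots\widehat{A_i}\cdots\bigtriangleup[A_i,A_j]\bigtriangleup\cdots\bigtriangleup A_m ,$$ where $a_s$ is the degree of $A_s$ and $[A_i,A_j]$ stands in the place of $A_j$; $\partial\circ\partial=0$. Weights: For $A_s\in\mathfrak g(i_s)_{j_s}$ the product $A_1\bigtriangleup\cdots\bigtriangleup A_m$ has primary weight $\sum_{s=1}^m i_s$ and secondary weight $-m+\sum_{s=1}^m j_s$. $C_{m,w,h}$ denotes the span of all such products of length $m$ with primary weight $w$ and secondary weight $h$; $\partial$ maps $C_{m,w,h}$ to $C_{m-1,w,h}$. *)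

theory Defs
  imports Complex_Main "HOL-Computational_Algebra.Polynomial" "HOL-Library.Poly_Mapping"
begin

text \<open>
  A homogeneous element: \<open>VField p\<close>, \<open>Func p\<close> and \<open>OneForm p\<close> stand for the vector field
  \<open>p(x) d/dx\<close>, the function \<open>p(x)\<close> and the 1-form \<open>p(x) dx\<close>, so that each of the three
  graded parts is a copy of the vector space of real polynomials.
\<close>

datatype homog = VField "real poly" | Func "real poly" | OneForm "real poly"

fun deg :: "homog \<Rightarrow> nat" where
  "deg (VField p) = 0"
| "deg (Func f) = 1"
| "deg (OneForm g) = 2"

text \<open>
  \<open>[X, \<alpha>] = L\<^sub>X \<alpha> = - [\<alpha>, X]\<close> with \<open>L\<^sub>X f = p f'\<close> and
  \<open>L\<^sub>X (g dx) = d (i\<^sub>X (g dx)) = (p g)' dx\<close> for \<open>X = p d/dx\<close>, and \<open>[f, g] = d (f g) = (f g)' dx\<close>.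
  In the last three equations the bracket lies in degree 3 or 4, where the algebra is zero;
  the zero is written in a part of the same parity as that degree.
\<close>

fun bracket :: "homog \<Rightarrow> homog \<Rightarrow> homog" where
  "bracket (VField p) (VField q) = VField (p * pderiv q - q * pderiv p)"
| "bracket (VField p) (Func f) = Func (p * pderiv f)"
| "bracket (VField p) (OneForm g) = OneForm (pderiv (p * g))"
| "bracket (Func f) (VField p) = Func (- (p * pderiv f))"
| "bracket (OneForm g) (VField p) = OneForm (- pderiv (p * g))"
| "bracket (Func f) (Func g) = OneForm (pderiv (f * g))"
| "bracket (Func f) (OneForm g) = Func 0"
| "bracket (OneForm g) (Func f) = Func 0"
| "bracket (OneForm g) (OneForm h) = OneForm 0"

definition gpart :: "nat \<Rightarrow> nat \<Rightarrow> homog set" where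
  "gpart i j = {A. deg A = i \<and> (\<exists>c. A \<in> {VField (monom c j), Func (monom c j), OneForm (monom c j)})}"

instantiation poly_mapping :: (type, real_vector) real_vector
begin

lift_definition scaleR_poly_mapping :: "real \<Rightarrow> ('a \<Rightarrow>\<^sub>0 'b) \<Rightarrow> 'a \<Rightarrow>\<^sub>0 'b"
  is "\<lambda>c f x. c *\<^sub>R f x"
  by (erule finite_subset[rotated]) auto

instance
  by standard (transfer; simp add: fun_eq_iff scaleR_add_right scaleR_add_left)+

end

lemma lookup_scaleR [simp]: "Poly_Mapping.lookup (c *\<^sub>R f) x = c *\<^sub>R Poly_Mapping.lookup f x"
  by transfer simp

lemma scaleR_single: "c *\<^sub>R Poly_Mapping.single w d = Poly_Mapping.single w (c *\<^sub>R d)"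
  by (rule poly_mapping_eqI) (simp add: lookup_single when_def)

type_synonym free = "homog list \<Rightarrow>\<^sub>0 real"

abbreviation word :: "homog list \<Rightarrow> free" where
  "word w \<equiv> Poly_Mapping.single w 1"

definition lin_ext :: "(homog list \<Rightarrow> 'v::real_vector) \<Rightarrow> free \<Rightarrow> 'v" where
  "lin_ext g f = (\<Sum>w\<in>Poly_Mapping.keys f. Poly_Mapping.lookup f w *\<^sub>R g w)"

lemma lin_ext_superset:
  assumes "finite S" "Poly_Mapping.keys f \<subseteq> S"
  shows "lin_ext g f = (\<Sum>w\<in>S. Poly_Mapping.lookup f w *\<^sub>R g w)"
  unfolding lin_ext_def
  by (rule sum.mono_neutral_left) (use assms in \<open>auto simp: in_keys_iff\<close>)

lemma linear_lin_ext: "linear (lin_ext g)"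
proof
  fix x y :: free and c :: real
  let ?S = "Poly_Mapping.keys x \<union> Poly_Mapping.keys y"
  have "lin_ext g (x + y) = (\<Sum>w\<in>?S. Poly_Mapping.lookup (x + y) w *\<^sub>R g w)"
    by (rule lin_ext_superset) (auto simp: Poly_Mapping.keys_add)
  also have "\<dots> = (\<Sum>w\<in>?S. Poly_Mapping.lookup x w *\<^sub>R g w) + (\<Sum>w\<in>?S. Poly_Mapping.lookup y w *\<^sub>R g w)"
    by (simp add: lookup_add scaleR_add_left sum.distrib)
  also have "\<dots> = lin_ext g x + lin_ext g y"
    by (simp add: lin_ext_superset[symmetric])
  finally show "lin_ext g (x + y) = lin_ext g x + lin_ext g y" .
  have "lin_ext g (c *\<^sub>R x) = (\<Sum>w\<in>Poly_Mapping.keys x. Poly_Mapping.lookup (c *\<^sub>R x) w *\<^sub>R g w)"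
    by (rule lin_ext_superset) (auto simp: in_keys_iff)
  then show "lin_ext g (c *\<^sub>R x) = c *\<^sub>R lin_ext g x"
    by (simp add: lin_ext_def scaleR_sum_right)
qed

lemma lin_ext_word [simp]: "lin_ext g (word w) = g w"
  by (simp add: lin_ext_def)

lemma lin_ext_single [simp]: "lin_ext g (Poly_Mapping.single w c) = c *\<^sub>R g w"
  by (cases "c = 0") (simp_all add: lin_ext_def)

lemmas lin_ext_simps [simp] =
  linear_add[OF linear_lin_ext] linear_diff[OF linear_lin_ext] linear_cmul[OF linear_lin_ext]
  linear_neg[OF linear_lin_ext] linear_0[OF linear_lin_ext] linear_sum[OF linear_lin_ext]

lemma free_as_sum:
  "f = (\<Sum>w\<in>Poly_Mapping.keys f. Poly_Mapping.single w (Poly_Mapping.lookup f w))" for f :: free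
  by (rule poly_mapping_eqI)
     (auto simp: lookup_sum lookup_single when_def in_keys_iff sum.delta)

lemma free_linear_mem:
  fixes f :: free
  assumes "linear F" "subspace S" "\<And>w. F (word w) \<in> S"
  shows "F f \<in> S"
proof -
  have "f = (\<Sum>w\<in>Poly_Mapping.keys f. Poly_Mapping.lookup f w *\<^sub>R word w)"
    using free_as_sum[of f] by (simp add: scaleR_single)
  then have "F f = (\<Sum>w\<in>Poly_Mapping.keys f. Poly_Mapping.lookup f w *\<^sub>R F (word w))"
    using linear_sum[OF assms(1)] linear_cmul[OF assms(1)] by (metis (no_types, lifting) sum.cong)
  then show ?thesis
    using assms by (simp add: subspace_sum subspace_scale)
qed

text \<open>
  The defining relations of \<open>\<triangle>\<close>, each in an arbitrary context of factors on the left and on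
  the right: linearity in every factor, and super skew-symmetry of neighbouring factors.
\<close>

definition relations :: "free set" where
  "relations =
     {word (u @ [K (smult c p + q)] @ v) - c *\<^sub>R word (u @ [K p] @ v) - word (u @ [K q] @ v)
        | K u v c p q. K \<in> {VField, Func, OneForm}} \<union>
     {word (u @ [A, B] @ v) + (- 1) ^ (deg A * deg B) *\<^sub>R word (u @ [B, A] @ v) | A B u v. True}"

definition rel_space :: "free set" where
  "rel_space = span relations"

lemma subspace_rel_space [simp]: "subspace rel_space"
  by (simp add: rel_space_def)

lemma rel_space_lin:
  assumes "K \<in> {VField, Func, OneForm}"
  shows "word (u @ [K (smult c p + q)] @ v) - c *\<^sub>R word (u @ [K p] @ v) - word (u @ [K q] @ v)
     \<in> rel_space"
  unfolding rel_space_def relations_def by (rule span_base) (use assms in blast)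

lemma rel_space_skew:
  "word (u @ [A, B] @ v) + (- 1) ^ (deg A * deg B) *\<^sub>R word (u @ [B, A] @ v) \<in> rel_space"
  unfolding rel_space_def relations_def by (rule span_base) blast

definition chain_eq :: "free \<Rightarrow> free \<Rightarrow> bool" where
  "chain_eq x y \<longleftrightarrow> x - y \<in> rel_space"

lemma equivp_chain_eq: "equivp chain_eq"
proof (rule equivpI)
  show "reflp chain_eq"
    by (auto simp: reflp_def chain_eq_def subspace_0)
  show "symp chain_eq"
    unfolding symp_def chain_eq_def by (metis minus_diff_eq subspace_neg subspace_rel_space)
  show "transp chain_eq"
    unfolding transp_def chain_eq_def
    by (metis (no_types, lifting) diff_add_cancel add_diff_eq subspace_add subspace_rel_space)
qed

quotient_type chain = free / chain_eq
  by (rule equivp_chain_eq)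

instantiation chain :: real_vector
begin

lift_definition zero_chain :: chain is "0 :: free" .

lift_definition plus_chain :: "chain \<Rightarrow> chain \<Rightarrow> chain" is "(+)"
  unfolding chain_eq_def by (metis add_diff_add subspace_add subspace_rel_space)

lift_definition uminus_chain :: "chain \<Rightarrow> chain" is uminus
  unfolding chain_eq_def by (metis minus_diff_minus subspace_neg subspace_rel_space)

lift_definition minus_chain :: "chain \<Rightarrow> chain \<Rightarrow> chain" is "(-)"
proof -
  fix a b c d :: free
  assume "chain_eq a b" "chain_eq c d"
  then have "(a - b) - (c - d) \<in> rel_space"
    unfolding chain_eq_def by (simp add: subspace_diff)
  then show "chain_eq (a - c) (b - d)"
    unfolding chain_eq_def by (simp add: algebra_simps)
qed

lift_definition scaleR_chain :: "real \<Rightarrow> chain \<Rightarrow> chain" is scaleR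
  unfolding chain_eq_def by (metis scaleR_diff_right subspace_scale subspace_rel_space)

instance
  by standard
     (transfer; simp add: equivp_reflp[OF equivp_chain_eq] algebra_simps;
       simp add: chain_eq_def subspace_0)+

end

text \<open>\<open>triangle [A\<^sub>1, \<dots>, A\<^sub>m]\<close> is the product \<open>A\<^sub>1 \<triangle> \<cdots> \<triangle> A\<^sub>m\<close>.\<close>

definition triangle :: "homog list \<Rightarrow> chain" where
  "triangle w = abs_chain (word w)"

definition chain_space :: "nat \<Rightarrow> nat \<Rightarrow> int \<Rightarrow> chain set" where
  "chain_space m w h = span {triangle As | As is js.
      length As = m \<and> length is = m \<and> length js = m \<and>
      (\<forall>s<m. As ! s \<in> gpart (is ! s) (js ! s)) \<and>
      sum_list is = w \<and> int (sum_list js) - int m = h}"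

text \<open>
  Positions are counted from 0, so the sign exponent has \<open>i\<close> where the usual formula has
  \<open>i - 1\<close>.
\<close>

definition boundary_word :: "homog list \<Rightarrow> free" where
  "boundary_word As = (\<Sum>j<length As. \<Sum>i<j.
     (- 1) ^ (i + deg (As ! i) * (\<Sum>s\<in>{i<..<j}. deg (As ! s))) *\<^sub>R
       word (take i As @ drop (Suc i) (As[j := bracket (As ! i) (As ! j)])))"

text \<open>
  The linear extension of \<open>boundary_word\<close> respects the relations: this follows from
  \<open>\<partial> (A \<triangle> w) = ad\<^sub>A w - A \<triangle> \<partial> w\<close> for the superderivation \<open>ad\<^sub>A\<close>.
\<close>

definition ad_word :: "homog \<Rightarrow> homog list \<Rightarrow> free" where
  "ad_word A w = (\<Sum>j<length w. (- 1) ^ (deg A * (\<Sum>s<j. deg (w ! s))) *\<^sub>R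
     word (w[j := bracket A (w ! j)]))"

abbreviation lmul :: "homog list \<Rightarrow> free \<Rightarrow> free" where
  "lmul u \<equiv> lin_ext (\<lambda>w. word (u @ w))"

abbreviation rmul :: "homog list \<Rightarrow> free \<Rightarrow> free" where
  "rmul v \<equiv> lin_ext (\<lambda>w. word (w @ v))"

lemma lmul_append: "lmul u (lmul v f) = lmul (u @ v) f"
proof -
  have lin: "linear (\<lambda>f. lmul u (lmul v f) - lmul (u @ v) f)"
    by (intro linear_compose_sub linear_lin_ext
        linear_compose[OF linear_lin_ext linear_lin_ext, unfolded o_def])
  have "lmul u (lmul v f) - lmul (u @ v) f \<in> {0}"
    by (rule free_linear_mem[OF lin]) simp_all
  then show ?thesis by simp
qed

lemma boundary_word_Nil [simp]: "boundary_word [] = 0"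
  by (simp add: boundary_word_def)

lemma boundary_word_Cons: "boundary_word (A # w) = ad_word A w - lmul [A] (boundary_word w)"
proof -
  have shift: "(\<Sum>s\<in>{Suc i<..<Suc j}. deg (w ! (s - Suc 0))) = (\<Sum>s\<in>{i<..<j}. deg (w ! s))" for i j
    by (rule sum.reindex_bij_witness[where i = Suc and j = "\<lambda>s. s - 1"]) auto
  have shift0: "(\<Sum>s\<in>{0<..<Suc j}. deg (w ! (s - Suc 0))) = (\<Sum>s<j. deg (w ! s))" for j
    by (rule sum.reindex_bij_witness[where i = Suc and j = "\<lambda>s. s - 1"]) auto
  show ?thesis
    unfolding boundary_word_def ad_word_def
    by (simp add: sum.lessThan_Suc_shift shift shift0 sum.distrib sum_negf
             del: sum.lessThan_Suc)
       (simp add: sum_subtractf)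
qed

lemma ad_word_Nil [simp]: "ad_word A [] = 0"
  by (simp add: ad_word_def)

lemma ad_word_append:
  "ad_word A (u @ v) = rmul v (ad_word A u) +
     (- 1) ^ (deg A * sum_list (map deg u)) *\<^sub>R lmul u (ad_word A v)"
proof -
  have split: "(\<Sum>j<m + n. f j) = (\<Sum>j<m. f j) + (\<Sum>j<n. f (m + j))"
    for f :: "nat \<Rightarrow> 'b::comm_monoid_add" and m n :: nat
    by (induction n) (simp_all add: add.assoc)
  have pre: "(\<Sum>s<j. deg ((u @ v) ! s)) = (\<Sum>s<j. deg (u ! s))" if "j < length u" for j
    by (rule sum.cong) (use that in \<open>auto simp: nth_append\<close>)
  have post: "(\<Sum>s<length u + j. deg (if s < length u then u ! s else v ! (s - length u))) = sum_list (map deg u) + (\<Sum>s<j. deg (v ! s))" for j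
    unfolding split by (simp add: sum_list_sum_nth atLeast0LessThan)
  have 1: "(\<Sum>j<length u. (- 1) ^ (deg A * (\<Sum>s<j. deg ((u @ v) ! s))) *\<^sub>R
     word ((u @ v)[j := bracket A ((u @ v) ! j)])) = rmul v (ad_word A u)"
    unfolding ad_word_def lin_ext_simps
    by (rule sum.cong) (auto simp: pre nth_append list_update_append)
  have 2: "(\<Sum>j<length v. (- 1) ^ (deg A * (\<Sum>s<length u + j. deg ((u @ v) ! s))) *\<^sub>R
     word ((u @ v)[length u + j := bracket A ((u @ v) ! (length u + j))])) =
     (- 1) ^ (deg A * sum_list (map deg u)) *\<^sub>R lmul u (ad_word A v)"
    unfolding ad_word_def lin_ext_simps scaleR_sum_right
    by (rule sum.cong) (auto simp: post nth_append list_update_append power_add distrib_left)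
  show ?thesis
    using 1 2 unfolding ad_word_def[of A "u @ v"] length_append split by simp
qed

lemma ad_word_single [simp]: "ad_word A [B] = word [bracket A B]"
  by (simp add: ad_word_def)

lemma lin_ext_rel_space:
  assumes "x \<in> rel_space" "subspace S" "\<And>r. r \<in> relations \<Longrightarrow> lin_ext g r \<in> S"
  shows "lin_ext g x \<in> S"
proof -
  have "rel_space \<subseteq> lin_ext g -` S"
    unfolding rel_space_def
    by (rule span_minimal) (use assms in \<open>auto intro: linear_subspace_vimage linear_lin_ext\<close>)
  with assms(1) show ?thesis by auto
qed

lemma relations_cases:
  assumes "r \<in> relations"
  obtains (lin) K u v c p q where "K \<in> {VField, Func, OneForm}"
      "r = word (u @ [K (smult c p + q)] @ v) - c *\<^sub>R word (u @ [K p] @ v) - word (u @ [K q] @ v)"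
    | (skew) A B u v where
      "r = word (u @ [A, B] @ v) + (- 1) ^ (deg A * deg B) *\<^sub>R word (u @ [B, A] @ v)"
  using assms unfolding relations_def by blast

lemma lmul_rel_space: "x \<in> rel_space \<Longrightarrow> lmul t x \<in> rel_space"
proof (erule lin_ext_rel_space, simp)
  fix r assume "r \<in> relations"
  then show "lmul t r \<in> rel_space"
  proof (cases r rule: relations_cases)
    case (lin K u v c p q)
    then show ?thesis using rel_space_lin[of K "t @ u" c p q v] by simp
  next
    case (skew A B u v)
    then show ?thesis using rel_space_skew[of "t @ u" A B v] by simp
  qed
qed

lemma rmul_rel_space: "x \<in> rel_space \<Longrightarrow> rmul t x \<in> rel_space"
proof (erule lin_ext_rel_space, simp)
  fix r assume "r \<in> relations"
  then show "rmul t r \<in> rel_space"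
  proof (cases r rule: relations_cases)
    case (lin K u v c p q)
    then show ?thesis using rel_space_lin[of K u c p q "v @ t"] by simp
  next
    case (skew A B u v)
    then show ?thesis using rel_space_skew[of u A B "v @ t"] by simp
  qed
qed

lemma rmul_lin:
  assumes "K \<in> {VField, Func, OneForm}"
  shows "rmul ([K (smult c p + q)] @ v) f - c *\<^sub>R rmul ([K p] @ v) f - rmul ([K q] @ v) f \<in> rel_space"
  by (rule free_linear_mem[where F = "\<lambda>f. rmul ([K (smult c p + q)] @ v) f -
        c *\<^sub>R rmul ([K p] @ v) f - rmul ([K q] @ v) f"])
     (use rel_space_lin[OF assms, of _ c p q v] in
       \<open>auto intro!: linear_compose_sub linear_compose_scale_right linear_lin_ext\<close>)

lemma lmul_lin:
  assumes "K \<in> {VField, Func, OneForm}"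
  shows "lmul (u @ [K (smult c p + q)]) f - c *\<^sub>R lmul (u @ [K p]) f - lmul (u @ [K q]) f \<in> rel_space"
  by (rule free_linear_mem[where F = "\<lambda>f. lmul (u @ [K (smult c p + q)]) f -
        c *\<^sub>R lmul (u @ [K p]) f - lmul (u @ [K q]) f"])
     (use rel_space_lin[OF assms, of u c p q] in
       \<open>auto intro!: linear_compose_sub linear_compose_scale_right linear_lin_ext\<close>)

lemma rmul_skew:
  "rmul ([A, B] @ v) f + (- 1) ^ (deg A * deg B) *\<^sub>R rmul ([B, A] @ v) f \<in> rel_space"
  by (rule free_linear_mem[where F = "\<lambda>f. rmul ([A, B] @ v) f +
        (- 1) ^ (deg A * deg B) *\<^sub>R rmul ([B, A] @ v) f"])
     (use rel_space_skew[of _ A B v] in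
       \<open>auto intro!: linear_compose_add linear_compose_scale_right linear_lin_ext\<close>)

lemma lmul_skew:
  "lmul (u @ [A, B]) f + (- 1) ^ (deg A * deg B) *\<^sub>R lmul (u @ [B, A]) f \<in> rel_space"
  by (rule free_linear_mem[where F = "\<lambda>f. lmul (u @ [A, B]) f +
        (- 1) ^ (deg A * deg B) *\<^sub>R lmul (u @ [B, A]) f"])
     (use rel_space_skew[of u A B] in
       \<open>auto intro!: linear_compose_add linear_compose_scale_right linear_lin_ext\<close>)

lemma bracket_lin_right:
  assumes "K \<in> {VField, Func, OneForm}"
  obtains K' \<phi> where "K' \<in> {VField, Func, OneForm}" "\<And>p. bracket A (K p) = K' (\<phi> p)"
    "\<And>c p q. \<phi> (smult c p + q) = smult c (\<phi> p) + \<phi> q"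
proof -
  have "\<exists>K' \<phi>. K' \<in> {VField, Func, OneForm} \<and> (\<forall>p. bracket A (K p) = K' (\<phi> p)) \<and>
    (\<forall>c p q. \<phi> (smult c p + q) = smult c (\<phi> p) + \<phi> q)"
  proof (cases A)
    case (VField a)
    consider "K = VField" | "K = Func" | "K = OneForm" using assms by blast
    then show ?thesis
    proof cases
      case 1 then show ?thesis
        by (intro exI[of _ VField] exI[of _ "\<lambda>p. a * pderiv p - p * pderiv a"])
           (auto simp: VField pderiv_add pderiv_smult algebra_simps smult_diff_right)
    next
      case 2 then show ?thesis
        by (intro exI[of _ Func] exI[of _ "\<lambda>p. a * pderiv p"])
           (auto simp: VField pderiv_add pderiv_smult algebra_simps)
    next
      case 3 then show ?thesis
        by (intro exI[of _ OneForm] exI[of _ "\<lambda>p. pderiv (a * p)"])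
           (auto simp: VField pderiv_add pderiv_smult algebra_simps)
    qed
  next
    case (Func a)
    consider "K = VField" | "K = Func" | "K = OneForm" using assms by blast
    then show ?thesis
    proof cases
      case 1 then show ?thesis
        by (intro exI[of _ Func] exI[of _ "\<lambda>p. - (p * pderiv a)"])
           (auto simp: Func algebra_simps)
    next
      case 2 then show ?thesis
        by (intro exI[of _ OneForm] exI[of _ "\<lambda>p. pderiv (a * p)"])
           (auto simp: Func pderiv_add pderiv_smult algebra_simps)
    next
      case 3 then show ?thesis
        by (intro exI[of _ Func] exI[of _ "\<lambda>p. 0"]) (auto simp: Func)
    qed
  next
    case (OneForm a)
    consider "K = VField" | "K = Func" | "K = OneForm" using assms by blast
    then show ?thesis
    proof cases
      case 1 then show ?thesis
        by (intro exI[of _ OneForm] exI[of _ "\<lambda>p. - pderiv (p * a)"])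
           (auto simp: OneForm pderiv_add pderiv_smult algebra_simps)
    next
      case 2 then show ?thesis
        by (intro exI[of _ Func] exI[of _ "\<lambda>p. 0"]) (auto simp: OneForm)
    next
      case 3 then show ?thesis
        by (intro exI[of _ OneForm] exI[of _ "\<lambda>p. 0"]) (auto simp: OneForm)
    qed
  qed
  then show ?thesis using that by blast
qed

lemma bracket_lin_left:
  assumes "K \<in> {VField, Func, OneForm}"
  obtains K' \<phi> where "K' \<in> {VField, Func, OneForm}" "\<And>p. bracket (K p) B = K' (\<phi> p)"
    "\<And>c p q. \<phi> (smult c p + q) = smult c (\<phi> p) + \<phi> q"
proof -
  have "\<exists>K' \<phi>. K' \<in> {VField, Func, OneForm} \<and> (\<forall>p. bracket (K p) B = K' (\<phi> p)) \<and>
    (\<forall>c p q. \<phi> (smult c p + q) = smult c (\<phi> p) + \<phi> q)"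
  proof (cases B)
    case (VField a)
    consider "K = VField" | "K = Func" | "K = OneForm" using assms by blast
    then show ?thesis
    proof cases
      case 1 then show ?thesis
        by (intro exI[of _ VField] exI[of _ "\<lambda>p. p * pderiv a - a * pderiv p"])
           (auto simp: VField pderiv_add pderiv_smult algebra_simps smult_diff_right)
    next
      case 2 then show ?thesis
        by (intro exI[of _ Func] exI[of _ "\<lambda>p. - (a * pderiv p)"])
           (auto simp: VField pderiv_add pderiv_smult algebra_simps)
    next
      case 3 then show ?thesis
        by (intro exI[of _ OneForm] exI[of _ "\<lambda>p. - pderiv (a * p)"])
           (auto simp: VField pderiv_add pderiv_smult algebra_simps)
    qed
  next
    case (Func a)
    consider "K = VField" | "K = Func" | "K = OneForm" using assms by blast
    then show ?thesis
    proof cases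
      case 1 then show ?thesis
        by (intro exI[of _ Func] exI[of _ "\<lambda>p. p * pderiv a"])
           (auto simp: Func algebra_simps)
    next
      case 2 then show ?thesis
        by (intro exI[of _ OneForm] exI[of _ "\<lambda>p. pderiv (p * a)"])
           (auto simp: Func pderiv_add pderiv_smult algebra_simps)
    next
      case 3 then show ?thesis
        by (intro exI[of _ Func] exI[of _ "\<lambda>p. 0"]) (auto simp: Func)
    qed
  next
    case (OneForm a)
    consider "K = VField" | "K = Func" | "K = OneForm" using assms by blast
    then show ?thesis
    proof cases
      case 1 then show ?thesis
        by (intro exI[of _ OneForm] exI[of _ "\<lambda>p. pderiv (p * a)"])
           (auto simp: OneForm pderiv_add pderiv_smult algebra_simps)
    next
      case 2 then show ?thesis
        by (intro exI[of _ Func] exI[of _ "\<lambda>p. 0"]) (auto simp: OneForm)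
    next
      case 3 then show ?thesis
        by (intro exI[of _ OneForm] exI[of _ "\<lambda>p. 0"]) (auto simp: OneForm)
    qed
  qed
  then show ?thesis using that by blast
qed

lemma deg_const:
  "K \<in> {VField, Func, OneForm} \<Longrightarrow> deg (K p) = deg (K q)"
  by auto

lemma zero_factor:
  assumes "K \<in> {VField, Func, OneForm}"
  shows "word (u @ [K 0] @ v) \<in> rel_space"
proof -
  have "- word (u @ [K 0] @ v) \<in> rel_space"
    using rel_space_lin[OF assms, of u 1 0 0 v] by (simp)
  then show ?thesis
    by (metis minus_minus subspace_neg subspace_rel_space)
qed

lemma uminus_factor:
  assumes "K \<in> {VField, Func, OneForm}"
  shows "word (u @ [K p] @ v) + word (u @ [K (- p)] @ v) \<in> rel_space"
proof -
  have "word (u @ [K (smult (- 1) p + 0)] @ v) - (- 1) *\<^sub>R word (u @ [K p] @ v) - word (u @ [K 0] @ v)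
     \<in> rel_space"
    by (rule rel_space_lin[OF assms])
  from subspace_add[OF subspace_rel_space this zero_factor[OF assms, of u v]]
  show ?thesis by (simp add: add.commute)
qed

lemma bracket_skew:
  "word (u @ [bracket A B] @ v) + (- 1) ^ (deg A * deg B) *\<^sub>R word (u @ [bracket B A] @ v) \<in> rel_space"
proof (cases A; cases B)
  fix p q assume AB: "A = VField p" "B = VField q"
  have "q * pderiv p - p * pderiv q = - (p * pderiv q - q * pderiv p)" by simp
  then show ?thesis
    using uminus_factor[of VField u "p * pderiv q - q * pderiv p" v]
    by (simp only: AB bracket.simps deg.simps) simp
next
  fix p q assume AB: "A = VField p" "B = Func q"
  then show ?thesis using uminus_factor[of Func u "p * pderiv q" v] by simp
next
  fix p q assume AB: "A = VField p" "B = OneForm q"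
  then show ?thesis using uminus_factor[of OneForm u "pderiv (p * q)" v] by simp
next
  fix p q assume AB: "A = Func p" "B = VField q"
  then show ?thesis using uminus_factor[of Func u "q * pderiv p" v] by (simp add: add.commute)
next
  fix p q assume AB: "A = OneForm p" "B = VField q"
  then show ?thesis using uminus_factor[of OneForm u "pderiv (q * p)" v] by (simp add: add.commute)
next
  fix p q assume AB: "A = Func p" "B = Func q"
  then show ?thesis by (simp add: mult.commute subspace_0)
next
  fix p q assume AB: "A = Func p" "B = OneForm q"
  then show ?thesis using zero_factor[of Func u v]
    by (auto intro!: subspace_add simp del: append_Cons)
next
  fix p q assume AB: "A = OneForm p" "B = Func q"
  then show ?thesis using zero_factor[of Func u v]
    by (auto intro!: subspace_add simp del: append_Cons)
next
  fix p q assume AB: "A = OneForm p" "B = OneForm q"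
  then show ?thesis using zero_factor[of OneForm u v]
    by (auto intro!: subspace_add simp del: append_Cons)
qed

lemma sign_bracket: "(- 1 :: real) ^ (deg (bracket A B) * n) = (- 1) ^ (deg A * n) * (- 1) ^ (deg B * n)"
  by (cases A; cases B) (simp_all add: power_add[symmetric] power_mult power_mult_distrib[symmetric])

lemma ad_rel_space:
  assumes "x \<in> rel_space"
  shows "lin_ext (ad_word D) x \<in> rel_space"
proof (rule lin_ext_rel_space[OF assms subspace_rel_space])
  fix r assume "r \<in> relations"
  then show "lin_ext (ad_word D) r \<in> rel_space"
  proof (cases r rule: relations_cases)
    case (lin K u v c p q)
    let ?s = "(- 1 :: real) ^ (deg D * sum_list (map deg u))"
    let ?t = "(- 1 :: real) ^ (deg D * deg (K p))"
    have d: "deg (K q) = deg (K p)" "deg (K (smult c p + q)) = deg (K p)"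
      using deg_const[OF lin(1)] by blast+
    obtain K' \<phi> where K': "K' \<in> {VField, Func, OneForm}" "\<And>p. bracket D (K p) = K' (\<phi> p)"
      "\<And>c p q. \<phi> (smult c p + q) = smult c (\<phi> p) + \<phi> q"
      using bracket_lin_right[OF lin(1)] by metis
    have expand: "ad_word D (u @ [K z] @ v) = rmul ([K z] @ v) (ad_word D u) +
        ?s *\<^sub>R word (u @ [K' (\<phi> z)] @ v) +
        (?s * (- 1) ^ (deg D * deg (K z))) *\<^sub>R lmul (u @ [K z]) (ad_word D v)" for z
      unfolding ad_word_append[of D u] ad_word_append[of D "[K z]"]
      using lmul_append[of u "[K z]" "ad_word D v"]
      by (simp add: K'(2) scaleR_add_right add.assoc)
    have "lin_ext (ad_word D) r =
       (rmul ([K (smult c p + q)] @ v) (ad_word D u) - c *\<^sub>R rmul ([K p] @ v) (ad_word D u)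
          - rmul ([K q] @ v) (ad_word D u))
       + ?s *\<^sub>R (word (u @ [K' (smult c (\<phi> p) + \<phi> q)] @ v) - c *\<^sub>R word (u @ [K' (\<phi> p)] @ v)
          - word (u @ [K' (\<phi> q)] @ v))
       + (?s * ?t) *\<^sub>R (lmul (u @ [K (smult c p + q)]) (ad_word D v) - c *\<^sub>R lmul (u @ [K p]) (ad_word D v)
          - lmul (u @ [K q]) (ad_word D v))"
      unfolding lin(2) lin_ext_simps lin_ext_word expand d K'(3)
      by (simp only: algebra_simps scaleR_add_right scaleR_diff_right scaleR_scaleR)
    also have "\<dots> \<in> rel_space"
      by (intro subspace_add[OF subspace_rel_space] subspace_scale[OF subspace_rel_space]
          rmul_lin[OF lin(1)] lmul_lin[OF lin(1)] rel_space_lin[OF K'(1)])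
    finally show ?thesis .
  next
    case (skew A B u v)
    let ?s = "(- 1 :: real) ^ (deg D * sum_list (map deg u))"
    let ?t = "(- 1 :: real) ^ (deg D * (deg A + deg B))"
    let ?e = "(- 1 :: real) ^ (deg A * deg B)"
    let ?a = "(- 1 :: real) ^ (deg D * deg A)" and ?b = "(- 1 :: real) ^ (deg D * deg B)"
    have expand: "ad_word D (u @ [X, Y] @ v) = rmul ([X, Y] @ v) (ad_word D u) +
        ?s *\<^sub>R word (u @ [bracket D X, Y] @ v) +
        (?s * (- 1) ^ (deg D * deg X)) *\<^sub>R word (u @ [X, bracket D Y] @ v) +
        (?s * (- 1) ^ (deg D * (deg X + deg Y))) *\<^sub>R lmul (u @ [X, Y]) (ad_word D v)" for X Y
    proof -
      have two: "ad_word D [X, Y] = word [bracket D X, Y] + (- 1) ^ (deg D * deg X) *\<^sub>R word [X, bracket D Y]"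
        using ad_word_append[of D "[X]" "[Y]"] by simp
      show ?thesis
        unfolding ad_word_append[of D u] ad_word_append[of D "[X, Y]"] two
        using lmul_append[of u "[X, Y]" "ad_word D v"]
        by (simp add: scaleR_add_right add.assoc)
    qed
    have sq: "?a * ?a = 1" "?b * ?b = 1" "?e * ?e = 1"
      by (simp_all flip: power_add)
    have 1: "word (u @ [bracket D A, B] @ v) + (?b * ?e) *\<^sub>R word (u @ [B, bracket D A] @ v) \<in> rel_space"
      using rel_space_skew[of u "bracket D A" B v] by (simp add: sign_bracket)
    have 2: "word (u @ [bracket D B, A] @ v) + (?a * ?e) *\<^sub>R word (u @ [A, bracket D B] @ v) \<in> rel_space"
      using rel_space_skew[of u "bracket D B" A v]
      by (simp only: sign_bracket mult.commute[of "deg B" "deg A"])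
    have 3: "?e * (?a * ?e) = ?a"
      using sq(3) by (metis mult.left_commute mult.right_neutral)
    have "lin_ext (ad_word D) r =
       (rmul ([A, B] @ v) (ad_word D u) + ?e *\<^sub>R rmul ([B, A] @ v) (ad_word D u))
       + ?s *\<^sub>R ((word (u @ [bracket D A, B] @ v) + (?b * ?e) *\<^sub>R word (u @ [B, bracket D A] @ v))
           + ?e *\<^sub>R (word (u @ [bracket D B, A] @ v) + (?a * ?e) *\<^sub>R word (u @ [A, bracket D B] @ v)))
       + (?s * ?t) *\<^sub>R (lmul (u @ [A, B]) (ad_word D v) + ?e *\<^sub>R lmul (u @ [B, A]) (ad_word D v))"
      unfolding skew lin_ext_simps lin_ext_word expand scaleR_add_right scaleR_scaleR 3
      by (simp only: mult_ac add_ac)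
    also have "\<dots> \<in> rel_space"
      by (intro subspace_add[OF subspace_rel_space] subspace_scale[OF subspace_rel_space]
          rmul_skew lmul_skew 1 2)
    finally show ?thesis .
  qed
qed

lemma ad_word_lin_left:
  assumes K: "K \<in> {VField, Func, OneForm}"
  shows "ad_word (K (smult c p + q)) w - c *\<^sub>R ad_word (K p) w - ad_word (K q) w \<in> rel_space"
proof -
  have d: "deg (K q) = deg (K p)" "deg (K (smult c p + q)) = deg (K p)"
    using deg_const[OF K] by blast+
  let ?s = "\<lambda>j. (- 1 :: real) ^ (deg (K p) * (\<Sum>s<j. deg (w ! s)))"
  let ?w = "\<lambda>z j. word (w[j := bracket (K z) (w ! j)])"
  have "ad_word (K (smult c p + q)) w - c *\<^sub>R ad_word (K p) w - ad_word (K q) w =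
     (\<Sum>j<length w. ?s j *\<^sub>R (?w (smult c p + q) j - c *\<^sub>R ?w p j - ?w q j))"
    unfolding ad_word_def d
    by (simp add: scaleR_sum_right sum_subtractf[symmetric] scaleR_diff_right mult.commute)
  also have "\<dots> \<in> rel_space"
  proof (intro subspace_sum[OF subspace_rel_space] subspace_scale[OF subspace_rel_space])
    fix j assume "j \<in> {..<length w}"
    then have j: "j < length w" by simp
    obtain K' \<phi> where K': "K' \<in> {VField, Func, OneForm}" "\<And>p. bracket (K p) (w ! j) = K' (\<phi> p)"
      "\<And>c p q. \<phi> (smult c p + q) = smult c (\<phi> p) + \<phi> q"
      using bracket_lin_left[OF K] by metis
    show "?w (smult c p + q) j - c *\<^sub>R ?w p j - ?w q j \<in> rel_space"
      using rel_space_lin[OF K'(1), of "take j w" c "\<phi> p" "\<phi> q" "drop (Suc j) w"]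
      by (simp add: K'(2,3) upd_conv_take_nth_drop[OF j])
  qed
  finally show ?thesis .
qed

lemma boundary_cong:
  assumes "x \<in> rel_space"
  shows "lin_ext boundary_word x \<in> rel_space"
proof (rule lin_ext_rel_space[OF assms subspace_rel_space])
  fix r assume "r \<in> relations"
  then show "lin_ext boundary_word r \<in> rel_space"
  proof (cases r rule: relations_cases)
    case (lin K u v c p q)
    show ?thesis unfolding lin(2)
    proof (induction u)
      case Nil
      let ?d = "boundary_word v"
      have "(ad_word (K (smult c p + q)) v - c *\<^sub>R ad_word (K p) v - ad_word (K q) v) -
          (lmul ([] @ [K (smult c p + q)]) ?d - c *\<^sub>R lmul ([] @ [K p]) ?d - lmul ([] @ [K q]) ?d)
          \<in> rel_space"
        by (intro subspace_diff[OF subspace_rel_space] ad_word_lin_left lmul_lin lin)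
      then show ?case
        by (simp add: boundary_word_Cons algebra_simps)
    next
      case (Cons A u)
      let ?x = "word (u @ [K (smult c p + q)] @ v) - c *\<^sub>R word (u @ [K p] @ v) - word (u @ [K q] @ v)"
      have "lin_ext (ad_word A) ?x - lmul [A] (lin_ext boundary_word ?x) \<in> rel_space"
        by (intro subspace_diff[OF subspace_rel_space] ad_rel_space lmul_rel_space rel_space_lin lin Cons)
      then show ?case
        by (simp add: boundary_word_Cons algebra_simps)
    qed
  next
    case (skew A B u v)
    show ?thesis unfolding skew
    proof (induction u)
      case Nil
      let ?d = "boundary_word v" and ?e = "(- 1 :: real) ^ (deg A * deg B)"
      have expand: "boundary_word (X # Y # v) = word (bracket X Y # v) +
          (- 1) ^ (deg X * deg Y) *\<^sub>R lmul [Y] (ad_word X v) - lmul [X] (ad_word Y v) +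
          lmul [X, Y] ?d" for X Y
        using ad_word_append[of X "[Y]" v] lmul_append[of "[X]" "[Y]" ?d]
        by (simp add: boundary_word_Cons)
      have "?e * ?e = 1"
        by (simp flip: power_add)
      then have "lin_ext boundary_word (word ([] @ [A, B] @ v) + ?e *\<^sub>R word ([] @ [B, A] @ v)) =
          (word ([] @ [bracket A B] @ v) + ?e *\<^sub>R word ([] @ [bracket B A] @ v)) +
          (lmul ([] @ [A, B]) ?d + ?e *\<^sub>R lmul ([] @ [B, A]) ?d)"
        by (simp add: expand mult.commute[of "deg B"] scaleR_add_right scaleR_diff_right)
      also have "\<dots> \<in> rel_space"
        by (intro subspace_add[OF subspace_rel_space] bracket_skew lmul_skew)
      finally show ?case .
    next
      case (Cons D u)
      let ?x = "word (u @ [A, B] @ v) + (- 1) ^ (deg A * deg B) *\<^sub>R word (u @ [B, A] @ v)"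
      have "lin_ext (ad_word D) ?x - lmul [D] (lin_ext boundary_word ?x) \<in> rel_space"
        by (intro subspace_diff[OF subspace_rel_space] ad_rel_space lmul_rel_space rel_space_skew Cons)
      then show ?case
        by (simp add: boundary_word_Cons algebra_simps)
    qed
  qed
qed

lift_definition boundary :: "chain \<Rightarrow> chain" is "lin_ext boundary_word"
  unfolding chain_eq_def by (drule boundary_cong) simp

lemma linear_abs_chain: "linear abs_chain"
  by standard (simp_all add: plus_chain.abs_eq scaleR_chain.abs_eq)

lemma linear_boundary: "linear boundary"
  by standard (transfer; simp add: equivp_reflp[OF equivp_chain_eq])+

theorem boundary_triangle:
  "boundary (triangle As) = (\<Sum>j<length As. \<Sum>i<j.
     (- 1) ^ (i + deg (As ! i) * (\<Sum>s\<in>{i<..<j}. deg (As ! s))) *\<^sub>R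
       triangle (take i As @ drop (Suc i) (As[j := bracket (As ! i) (As ! j)])))"
  by (simp add: triangle_def boundary.abs_eq boundary_word_def
      linear_sum[OF linear_abs_chain] linear_cmul[OF linear_abs_chain])

definition rank_on :: "('a::real_vector \<Rightarrow> 'b::real_vector) \<Rightarrow> 'a set \<Rightarrow> nat" where
  "rank_on f V = dim (f ` V)"

end

theory Submission
  imports Defs "HOL-Library.Multiset"
begin

text \<open>
  A basis element in \<open>\<gg>(i)\<^sub>j\<close> has excess \<open>i + j - 1\<close>, and the excesses of the factors of a
  product in \<open>C\<^bsub>m,w,-w\<^esub>\<close> add up to 0. Only \<open>d/dx\<close> has negative excess, and it occurs at most
  once because vector fields anticommute. So, up to order, a nonzero product consists of constant
  functions 1, at most one factor \<open>x d/dx\<close> (both of excess 0), and possibly \<open>d/dx\<close> together with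
  exactly one of the three basis elements \<open>x\<^sup>2 d/dx\<close>, \<open>x\<close>, \<open>dx\<close> of excess 1. For every \<open>w \<ge> 2\<close> this
  leaves the same generators apart from the number of factors 1, and their boundaries give the ranks
  1, 2, 0, 0 for \<open>k = 0, 1, 2, 3\<close>. Contractions with dual basis elements, which are superderivations
  of the chain algebra, show that the chains in question are nonzero.
\<close>

section \<open>Operators on chains\<close>

text \<open>Every product arises from \<open>triangle []\<close> by left multiplications. An
  operator with a known rule for passing \<open>cmul A\<close> can therefore be evaluated factor by
  factor, without the index sums of \<open>boundary_word\<close>.\<close>

lift_definition cmul :: "homog \<Rightarrow> chain \<Rightarrow> chain" is "\<lambda>A. lmul [A]"
  unfolding chain_eq_def by (metis lmul_rel_space linear_diff[OF linear_lin_ext])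

lift_definition ad :: "homog \<Rightarrow> chain \<Rightarrow> chain" is "\<lambda>A. lin_ext (ad_word A)"
  unfolding chain_eq_def by (drule ad_rel_space) simp

lemma linear_cmul_chain: "linear (cmul A)"
  by standard (transfer; simp add: equivp_reflp[OF equivp_chain_eq])+

lemma linear_ad: "linear (ad A)"
  by standard (transfer; simp add: equivp_reflp[OF equivp_chain_eq])+

lemmas cmul_simps [simp] =
  linear_add[OF linear_cmul_chain] linear_diff[OF linear_cmul_chain]
  linear_cmul[OF linear_cmul_chain] linear_neg[OF linear_cmul_chain] linear_0[OF linear_cmul_chain]

lemmas ad_simps [simp] =
  linear_add[OF linear_ad] linear_diff[OF linear_ad]
  linear_cmul[OF linear_ad] linear_neg[OF linear_ad] linear_0[OF linear_ad]

lemmas boundary_simps [simp] =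
  linear_add[OF linear_boundary] linear_diff[OF linear_boundary]
  linear_cmul[OF linear_boundary] linear_neg[OF linear_boundary] linear_0[OF linear_boundary]

lemma cmul_triangle: "cmul A (triangle w) = triangle (A # w)"
  by (simp add: triangle_def cmul.abs_eq)

text \<open>Words span the free space, so products span the quotient: the difference of the two
  maps, pulled back along \<open>abs_chain\<close>, is linear and kills every word.\<close>

lemma chain_linear_eqI:
  assumes "linear f" "linear g" "\<And>w. f (triangle w) = g (triangle w)"
  shows "f x = g x"
proof -
  obtain y where x: "x = abs_chain y"
    by (metis Quotient3_abs_rep Quotient3_chain)
  have "linear (\<lambda>y. f (abs_chain y) - g (abs_chain y))"
    by (intro linear_compose_sub linear_compose[OF linear_abs_chain, unfolded o_def] assms)
  then have "f (abs_chain y) - g (abs_chain y) \<in> {0}"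
    by (rule free_linear_mem) (use assms(3) in \<open>simp_all add: triangle_def\<close>)
  then show ?thesis
    by (simp add: x)
qed

lemma ad_cmul:
  "ad A (cmul B x) = cmul (bracket A B) x + (- 1) ^ (deg A * deg B) *\<^sub>R cmul B (ad A x)"
proof (rule chain_linear_eqI[where f = "\<lambda>x. ad A (cmul B x)"
      and g = "\<lambda>x. cmul (bracket A B) x + (- 1) ^ (deg A * deg B) *\<^sub>R cmul B (ad A x)"])
  show "linear (\<lambda>x. ad A (cmul B x))"
    by (intro linear_compose[unfolded o_def, of "cmul B" "ad A"] linear_cmul_chain linear_ad)
  show "linear (\<lambda>x. cmul (bracket A B) x + (- 1) ^ (deg A * deg B) *\<^sub>R cmul B (ad A x))"
    by (intro linear_compose_add linear_compose_scale_right linear_cmul_chain linear_ad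
        linear_compose[unfolded o_def, of "ad A" "cmul B"])
  show "ad A (cmul B (triangle w)) = cmul (bracket A B) (triangle w) +
      (- 1) ^ (deg A * deg B) *\<^sub>R cmul B (ad A (triangle w))" for w
    using ad_word_append[of A "[B]" w]
    by (simp add: cmul_triangle triangle_def ad.abs_eq cmul.abs_eq
        plus_chain.abs_eq scaleR_chain.abs_eq)
qed

text \<open>The pairs involving the new first factor make up \<open>ad A\<close>; in all other pairs
  every position is shifted by one, whence the minus sign.\<close>

lemma boundary_cmul: "boundary (cmul A x) = ad A x - cmul A (boundary x)"
proof (rule chain_linear_eqI[where f = "\<lambda>x. boundary (cmul A x)"
      and g = "\<lambda>x. ad A x - cmul A (boundary x)"])
  show "linear (\<lambda>x. boundary (cmul A x))"
    by (intro linear_compose[unfolded o_def, of "cmul A" boundary] linear_cmul_chain linear_boundary)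
  show "linear (\<lambda>x. ad A x - cmul A (boundary x))"
    by (intro linear_compose_sub linear_ad linear_cmul_chain linear_boundary
        linear_compose[unfolded o_def, of boundary "cmul A"])
  show "boundary (cmul A (triangle w)) = ad A (triangle w) - cmul A (boundary (triangle w))" for w
    by (simp add: cmul_triangle triangle_def ad.abs_eq cmul.abs_eq boundary.abs_eq
        minus_chain.abs_eq boundary_word_Cons)
qed

lemma ad_triangle_Nil [simp]: "ad A (triangle []) = 0"
  by (simp add: triangle_def ad.abs_eq zero_chain_def)

lemma boundary_triangle_Nil [simp]: "boundary (triangle []) = 0"
  by (simp add: triangle_def boundary.abs_eq zero_chain_def)

lemma abs_chain_eq_0_iff: "abs_chain x = 0 \<longleftrightarrow> x \<in> rel_space"
  by (simp add: zero_chain_def chain.abs_eq_iff chain_eq_def)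

lemma abs_chain_linear:
  "abs_chain (x + y) = abs_chain x + abs_chain y" "abs_chain (c *\<^sub>R x) = c *\<^sub>R abs_chain x"
  "abs_chain (x - y) = abs_chain x - abs_chain y"
  by (simp_all add: plus_chain.abs_eq scaleR_chain.abs_eq minus_chain.abs_eq)

section \<open>Multilinearity and super skew-symmetry in terms of left multiplication\<close>

lemma cmul_lin:
  assumes "K \<in> {VField, Func, OneForm}"
  shows "cmul (K (smult c p + q)) x = c *\<^sub>R cmul (K p) x + cmul (K q) x"
proof (rule chain_linear_eqI[where g = "\<lambda>x. c *\<^sub>R cmul (K p) x + cmul (K q) x"])
  show "linear (cmul (K (smult c p + q)))"
    by (rule linear_cmul_chain)
  show "linear (\<lambda>x. c *\<^sub>R cmul (K p) x + cmul (K q) x)"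
    by (intro linear_compose_add linear_compose_scale_right linear_cmul_chain)
  show "cmul (K (smult c p + q)) (triangle w) = c *\<^sub>R cmul (K p) (triangle w) + cmul (K q) (triangle w)"
    for w
    using rel_space_lin[OF assms, of "[]" c p q w]
    by (simp add: cmul_triangle)
      (simp add: triangle_def abs_chain_linear diff_diff_eq
        flip: abs_chain_eq_0_iff)
qed

lemma cmul_zero:
  "cmul (VField 0) x = 0" "cmul (Func 0) x = 0" "cmul (OneForm 0) x = 0"
  \<comment> \<open>With \<open>c = 1\<close> and \<open>p = q = 0\<close> linearity reads z = z +
    z.\<close>
  using cmul_lin[of VField 1 0 0 x] cmul_lin[of Func 1 0 0 x] cmul_lin[of OneForm 1 0 0 x] by simp_all

lemma cmul_smult:
  "cmul (VField (smult c p)) x = c *\<^sub>R cmul (VField p) x"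
  "cmul (Func (smult c p)) x = c *\<^sub>R cmul (Func p) x"
  "cmul (OneForm (smult c p)) x = c *\<^sub>R cmul (OneForm p) x"
  using cmul_lin[of VField c p 0 x] cmul_lin[of Func c p 0 x] cmul_lin[of OneForm c p 0 x]
  by (simp_all add: cmul_zero)

lemma cmul_commute: "cmul A (cmul B x) = - ((- 1) ^ (deg A * deg B) *\<^sub>R cmul B (cmul A x))"
proof (rule chain_linear_eqI[where f = "\<lambda>x. cmul A (cmul B x)"
      and g = "\<lambda>x. - ((- 1) ^ (deg A * deg B) *\<^sub>R cmul B (cmul A x))"])
  show "linear (\<lambda>x. cmul A (cmul B x))"
    by (intro linear_compose[unfolded o_def, of "cmul B" "cmul A"] linear_cmul_chain)
  show "linear (\<lambda>x. - ((- 1) ^ (deg A * deg B) *\<^sub>R cmul B (cmul A x)))"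
    by (intro linear_compose_neg linear_compose_scale_right linear_cmul_chain
        linear_compose[unfolded o_def, of "cmul A" "cmul B"])
  show "cmul A (cmul B (triangle w)) =
      - ((- 1) ^ (deg A * deg B) *\<^sub>R cmul B (cmul A (triangle w)))" for w
    using rel_space_skew[of "[]" A B w]
    by (simp add: cmul_triangle)
      (simp add: triangle_def abs_chain_linear eq_neg_iff_add_eq_0
        flip: abs_chain_eq_0_iff)
qed

section \<open>Contraction\<close>

text \<open>\<open>dual d j\<close> is the coefficient of the basis element of \<open>\<gg>(d)\<^sub>j\<close>.\<close>

fun dual :: "nat \<Rightarrow> nat \<Rightarrow> homog \<Rightarrow> real" where
  "dual d j (VField p) = (if d = 0 then coeff p j else 0)"
| "dual d j (Func p) = (if d = 1 then coeff p j else 0)"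
| "dual d j (OneForm p) = (if d = 2 then coeff p j else 0)"

lemma dual_eq_0: "deg A \<noteq> d \<Longrightarrow> dual d j A = 0"
  by (cases A) auto

lemma dual_lin:
  "K \<in> {VField, Func, OneForm} \<Longrightarrow> dual d j (K (smult c p + q)) = c * dual d j (K p) + dual d j (K q)"
  by auto

text \<open>The sign is that of a superderivation: for \<open>d = 0\<close> an interior product on
  anticommuting factors, while between functions (\<open>d = 1\<close>) it is +1, as for a partial
  derivative of polynomials.\<close>

fun contract_word :: "nat \<Rightarrow> nat \<Rightarrow> homog list \<Rightarrow> free" where
  "contract_word d j [] = 0"
| "contract_word d j (A # w) =
     dual d j A *\<^sub>R word w - (- 1) ^ (d * deg A) *\<^sub>R lmul [A] (contract_word d j w)"

lemma contract_cong:
  assumes "x \<in> rel_space"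
  shows "lin_ext (contract_word d j) x \<in> rel_space"
proof (rule lin_ext_rel_space[OF assms subspace_rel_space])
  let ?C = "lin_ext (contract_word d j)"
  fix r assume "r \<in> relations"
  then show "?C r \<in> rel_space"
  proof (cases r rule: relations_cases)
    case (lin K u v c p q)
    show ?thesis unfolding lin(2)
    proof (induction u)
      case Nil
      let ?d = "contract_word d j v"
      have d: "deg (K q) = deg (K p)" "deg (K (smult c p + q)) = deg (K p)"
        using deg_const[OF lin(1)] by blast+
      have "- ((- 1) ^ (d * deg (K p)) *\<^sub>R
          (lmul ([] @ [K (smult c p + q)]) ?d - c *\<^sub>R lmul ([] @ [K p]) ?d - lmul ([] @ [K q]) ?d))
          \<in> rel_space"
        by (intro subspace_neg[OF subspace_rel_space] subspace_scale[OF subspace_rel_space] lmul_lin lin)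
      then show ?case
        by (simp add: d dual_lin[OF lin(1)]) (simp add: algebra_simps)
    next
      case (Cons A u)
      let ?x = "word (u @ [K (smult c p + q)] @ v) - c *\<^sub>R word (u @ [K p] @ v) - word (u @ [K q] @ v)"
      have "dual d j A *\<^sub>R ?x - (- 1) ^ (d * deg A) *\<^sub>R lmul [A] (?C ?x) \<in> rel_space"
        by (intro subspace_diff[OF subspace_rel_space] subspace_scale[OF subspace_rel_space]
            lmul_rel_space rel_space_lin lin Cons)
      then show ?case
        by (simp add: algebra_simps)
    qed
  next
    case (skew A B u v)
    show ?thesis unfolding skew
    proof (induction u)
      case Nil
      let ?d = "contract_word d j v" and ?e = "(- 1 :: real) ^ (deg A * deg B)"
      let ?a = "(- 1 :: real) ^ (d * deg A)" and ?b = "(- 1 :: real) ^ (d * deg B)"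
      have expand: "contract_word d j (X # Y # v) = dual d j X *\<^sub>R word (Y # v)
          - ((- 1) ^ (d * deg X) * dual d j Y) *\<^sub>R word (X # v)
          + ((- 1) ^ (d * deg X) * (- 1) ^ (d * deg Y)) *\<^sub>R lmul [X, Y] ?d" for X Y
        using lmul_append[of "[X]" "[Y]" ?d] by (simp add: algebra_simps)
      have sq: "?e * ?e = 1"
        by (simp flip: power_add)
      \<comment> \<open>A nonzero dual value forces the degree to be \<open>d\<close>. Then the
        exchange sign \<open>?e\<close> equals \<open>?b\<close> (respectively \<open>?a\<close>),
        so the terms in which one of the two factors is removed cancel.\<close>
      have A: "dual d j A * (1 - ?e * ?b) = 0"
        using sq by (cases "deg A = d") (auto simp: dual_eq_0)
      have B: "dual d j B * (?e - ?a) = 0"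
        by (cases "deg B = d") (auto simp: dual_eq_0 mult.commute)
      have "?C (word ([] @ [A, B] @ v) + ?e *\<^sub>R word ([] @ [B, A] @ v)) =
          (dual d j A * (1 - ?e * ?b)) *\<^sub>R word (B # v) + (dual d j B * (?e - ?a)) *\<^sub>R word (A # v) +
          (?a * ?b) *\<^sub>R (lmul ([] @ [A, B]) ?d + ?e *\<^sub>R lmul ([] @ [B, A]) ?d)"
        unfolding lin_ext_simps lin_ext_word append.simps expand
        by (simp add: algebra_simps)
      also have "\<dots> \<in> rel_space"
        unfolding A B scaleR_zero_left add_0_left
        by (intro subspace_scale[OF subspace_rel_space] lmul_skew)
      finally show ?case .
    next
      case (Cons D u)
      let ?x = "word (u @ [A, B] @ v) + (- 1) ^ (deg A * deg B) *\<^sub>R word (u @ [B, A] @ v)"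
      have "dual d j D *\<^sub>R ?x - (- 1) ^ (d * deg D) *\<^sub>R lmul [D] (?C ?x) \<in> rel_space"
        by (intro subspace_diff[OF subspace_rel_space] subspace_scale[OF subspace_rel_space]
            lmul_rel_space rel_space_skew Cons)
      then show ?case
        by (simp add: algebra_simps)
    qed
  qed
qed

lift_definition contract :: "nat \<Rightarrow> nat \<Rightarrow> chain \<Rightarrow> chain" is "\<lambda>d j. lin_ext (contract_word d j)"
  unfolding chain_eq_def by (drule contract_cong) simp

lemma linear_contract: "linear (contract d j)"
  by standard (transfer; simp add: equivp_reflp[OF equivp_chain_eq])+

lemmas contract_simps [simp] =
  linear_add[OF linear_contract] linear_diff[OF linear_contract]
  linear_cmul[OF linear_contract] linear_neg[OF linear_contract] linear_0[OF linear_contract]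

lemma contract_cmul:
  "contract d j (cmul A x) = dual d j A *\<^sub>R x - (- 1) ^ (d * deg A) *\<^sub>R cmul A (contract d j x)"
proof (rule chain_linear_eqI[where f = "\<lambda>x. contract d j (cmul A x)"
      and g = "\<lambda>x. dual d j A *\<^sub>R x - (- 1) ^ (d * deg A) *\<^sub>R cmul A (contract d j x)"])
  show "linear (\<lambda>x. contract d j (cmul A x))"
    by (intro linear_compose[unfolded o_def, of "cmul A" "contract d j"] linear_cmul_chain linear_contract)
  show "linear (\<lambda>x. dual d j A *\<^sub>R x - (- 1) ^ (d * deg A) *\<^sub>R cmul A (contract d j x))"
    by (intro linear_compose_sub linear_compose_scale_right linear_ident linear_contract
        linear_compose[unfolded o_def, of "contract d j" "cmul A"] linear_cmul_chain)
  show "contract d j (cmul A (triangle w)) = dual d j A *\<^sub>R triangle w -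
      (- 1) ^ (d * deg A) *\<^sub>R cmul A (contract d j (triangle w))" for w
    by (simp add: cmul_triangle triangle_def cmul.abs_eq contract.abs_eq abs_chain_linear)
qed

lemma contract_triangle_Nil [simp]: "contract d j (triangle []) = 0"
  by (simp add: triangle_def contract.abs_eq zero_chain_def)

text \<open>Each defining relation involves nonempty words only, so the coefficient of the empty
  word vanishes on \<open>rel_space\<close> but not on \<open>word []\<close>.\<close>

lemma triangle_Nil_nonzero: "triangle [] \<noteq> 0"
proof -
  have lin: "linear (\<lambda>x :: free. Poly_Mapping.lookup x [])"
    by standard (simp_all add: lookup_add)
  have "rel_space \<subseteq> {x. Poly_Mapping.lookup x [] = 0}"
    unfolding rel_space_def
  proof (rule span_minimal)
    show "relations \<subseteq> {x. Poly_Mapping.lookup x [] = 0}"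
      by (auto simp: relations_def lookup_add lookup_minus lookup_single)
    show "subspace {x :: free. Poly_Mapping.lookup x [] = 0}"
      using linear_subspace_vimage[OF lin subspace_single_0] by (simp add: vimage_def)
  qed
  then show ?thesis
    by (auto simp: triangle_def abs_chain_eq_0_iff)
qed

section \<open>Products of basis elements\<close>

declare One_nat_def [simp del]

definition V :: "nat \<Rightarrow> homog" where "V j = VField (monom 1 j)"
definition F :: "nat \<Rightarrow> homog" where "F j = Func (monom 1 j)"
definition W :: "nat \<Rightarrow> homog" where "W j = OneForm (monom 1 j)"

lemma deg_basis [simp]: "deg (V j) = 0" "deg (F j) = 1" "deg (W j) = 2"
  by (simp_all add: V_def F_def W_def)

lemma dual_basis [simp]:
  "dual d i (V j) = (if d = 0 \<and> i = j then 1 else 0)"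
  "dual d i (F j) = (if d = 1 \<and> i = j then 1 else 0)"
  "dual d i (W j) = (if d = 2 \<and> i = j then 1 else 0)"
  by (auto simp: V_def F_def W_def)

text \<open>The rules are stated under \<open>cmul\<close> because scalars can be pulled out, and a
  zero bracket becomes the zero chain, only inside a product.\<close>

lemma cmul_bracket_basis [simp]:
  "cmul (bracket (V 0) (V 1)) x = cmul (V 0) x"
  "cmul (bracket (V 0) (V 2)) x = 2 *\<^sub>R cmul (V 1) x"
  "cmul (bracket (V 1) (V 2)) x = cmul (V 2) x"
  "cmul (bracket (V j) (F 0)) x = 0"
  "cmul (bracket (V 0) (F 1)) x = cmul (F 0) x"
  "cmul (bracket (V 1) (F 1)) x = cmul (F 1) x"
  "cmul (bracket (V 0) (W 0)) x = 0"
  "cmul (bracket (V 1) (W 0)) x = cmul (W 0) x"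
  "cmul (bracket (F 0) (F 0)) x = 0"
  "cmul (bracket (F 1) (F 0)) x = cmul (W 0) x"
  "cmul (bracket (W 0) (F 0)) x = 0"
proof -
  have two: "monom (2 :: real) i = smult 2 (monom 1 i)" for i
    by (simp add: smult_monom)
  show "cmul (bracket (V 0) (V 2)) x = 2 *\<^sub>R cmul (V 1) x"
    by (simp add: V_def pderiv_monom mult_monom two cmul_smult One_nat_def del: monom_0)
qed (simp_all add: V_def F_def W_def pderiv_monom mult_monom cmul_zero diff_monom One_nat_def
    flip: numeral_2_eq_2)

definition ones :: "nat \<Rightarrow> chain" where
  "ones n = triangle (replicate n (F 0))"

lemma ones_0: "ones 0 = triangle []"
  by (simp add: ones_def)

lemma ones_Suc: "ones (Suc n) = cmul (F 0) (ones n)"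
  by (simp add: ones_def cmul_triangle)

lemma contract_ones_0: "d \<noteq> 1 \<Longrightarrow> contract d j (ones n) = 0"
  by (induction n) (simp_all add: ones_0 ones_Suc contract_cmul)

text \<open>Functions commute, so \<open>ones\<close> behaves like a power and this contraction like
  its derivative.\<close>

lemma contract_ones: "contract 1 0 (ones (Suc n)) = real (Suc n) *\<^sub>R ones n"
  by (induction n) (simp_all add: ones_0 ones_Suc contract_cmul algebra_simps scaleR_2)

lemma ones_nonzero: "ones n \<noteq> 0"
proof (induction n)
  case 0
  then show ?case by (simp add: ones_0 triangle_Nil_nonzero)
next
  case (Suc n)
  \<comment> \<open>Were \<open>ones (Suc n)\<close> zero, its contraction, a nonzero multiple of
    \<open>ones n\<close>, would be zero too.\<close>
  then show ?case using contract_ones[of n] by auto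
qed

text \<open>Contraction with the dual of the leading factor kills the factors 1 and thus strips that
  factor off, leaving \<open>ones n\<close>. The next two lemmas treat a leading \<open>V 1\<close>
  in the same way.\<close>

lemma W_ones_nonzero: "cmul (W 0) (ones n) \<noteq> 0"
proof
  assume "cmul (W 0) (ones n) = 0"
  then have "contract 2 0 (cmul (W 0) (ones n)) = 0" by simp
  then show False
    by (simp add: contract_cmul contract_ones_0 ones_nonzero)
qed

lemma V_ones_nonzero: "cmul (V 1) (ones n) \<noteq> 0"
proof
  assume "cmul (V 1) (ones n) = 0"
  then have "contract 0 1 (cmul (V 1) (ones n)) = 0" by simp
  then show False
    by (simp add: contract_cmul contract_ones_0 ones_nonzero)
qed

lemma V_W_ones_nonzero: "cmul (V 1) (cmul (W 0) (ones n)) \<noteq> 0"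
proof
  assume "cmul (V 1) (cmul (W 0) (ones n)) = 0"
  then have "contract 0 1 (cmul (V 1) (cmul (W 0) (ones n))) = 0" by simp
  then show False
    by (simp add: contract_cmul contract_ones_0 W_ones_nonzero)
qed

section \<open>Boundaries of the generators\<close>

lemma ad_V_ones [simp]: "ad (V j) (ones n) = 0"
  by (induction n) (simp_all add: ones_0 ones_Suc ad_cmul)

lemma ad_F_0_ones [simp]: "ad (F 0) (ones n) = 0"
  by (induction n) (simp_all add: ones_0 ones_Suc ad_cmul)

lemma boundary_ones [simp]: "boundary (ones n) = 0"
  by (induction n) (simp_all add: ones_0 ones_Suc boundary_cmul)

text \<open>Each of the equal factors 1 contributes [x, 1] = dx. The superderivation sign picked up
  on reaching a factor cancels the sign of moving dx back to the front, so all terms agree.\<close>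

lemma ad_F_1_ones: "ad (F 1) (ones (Suc n)) = real (Suc n) *\<^sub>R cmul (W 0) (ones n)"
proof (induction n)
  case (Suc n)
  have "cmul (F 0) (cmul (W 0) (ones n)) = - cmul (W 0) (cmul (F 0) (ones n))"
    by (simp add: cmul_commute[of "F 0"])
  with Suc show ?case
    by (simp add: ones_Suc[of "Suc n"] ad_cmul)
       (simp add: ones_Suc algebra_simps scaleR_2)
qed (simp add: ones_0 ones_Suc ad_cmul)

lemma boundary_V_ones: "boundary (cmul (V j) (ones n)) = 0"
  by (simp add: boundary_cmul)

text \<open>The first term comes from [d/dx, x] = 1, the second from [x, 1] = dx with each constant
  factor.\<close>

lemma boundary_V_F_ones:
  "boundary (cmul (V 0) (cmul (F 1) (ones (Suc n)))) =
     ones (Suc (Suc n)) - real (Suc n) *\<^sub>R cmul (V 0) (cmul (W 0) (ones n))"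
  by (simp add: boundary_cmul ad_cmul ad_F_1_ones ones_Suc[of "Suc n"])

text \<open>The contributions of \<open>[V 0, V 1] = V 0\<close> and \<open>[V 1, W 0] = W 0\<close>
  are both the product of \<open>V 0\<close>, \<open>W 0\<close> and the constants, with opposite
  signs.\<close>

lemma boundary_V_V_W_ones:
  "boundary (cmul (V 0) (cmul (V 1) (cmul (W 0) (ones n)))) = 0"
proof -
  have "ad (W 0) (ones n) = 0"
    by (induction n) (simp_all add: ones_0 ones_Suc ad_cmul)
  then show ?thesis
    by (simp add: boundary_cmul ad_cmul)
qed

lemma boundary_V_V_ones:
  "boundary (cmul (V 0) (cmul (V 2) (ones n))) = 2 *\<^sub>R cmul (V 1) (ones n)"
  by (simp add: boundary_cmul ad_cmul)

text \<open>The contributions of \<open>[V 0, V 1] = V 0\<close> and \<open>[V 1, F 1] = F 1\<close>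
  cancel; those of \<open>[V 0, F 1] = F 0\<close> and \<open>[F 1, F 0] = W 0\<close>
  remain.\<close>

lemma boundary_V_V_F_ones:
  "boundary (cmul (V 0) (cmul (V 1) (cmul (F 1) (ones (Suc n))))) =
     cmul (V 1) (ones (Suc (Suc n))) + real (Suc n) *\<^sub>R cmul (V 0) (cmul (V 1) (cmul (W 0) (ones n)))"
  by (simp add: boundary_cmul ad_cmul ad_F_1_ones ones_Suc[of "Suc n"])

lemma cmul_self_even:
  assumes "even (deg A)"
  shows "cmul A (cmul A x) = 0"
proof -
  have "cmul A (cmul A x) = - cmul A (cmul A x)"
    using cmul_commute[of A A x] assms by simp
  then have "2 *\<^sub>R cmul A (cmul A x) = 0"
    by (metis add.right_inverse scaleR_2)
  then show ?thesis by simp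
qed

text \<open>The bracket of \<open>V 0\<close> with \<open>V 2\<close> produces a repeated
  \<open>V 1\<close>, hence 0; the other two brackets reproduce \<open>V 0\<close> and
  \<open>V 2\<close> and cancel.\<close>

lemma boundary_V_V_V_ones:
  "boundary (cmul (V 0) (cmul (V 1) (cmul (V 2) (ones n)))) = 0"
  by (simp add: boundary_cmul ad_cmul cmul_self_even)

section \<open>Generators of the chain spaces\<close>

text \<open>The pair (i, j) encodes the basis element of \<open>gpart i j\<close>. First components
  above 2 fall to \<open>W\<close> as a default, and \<open>weighted\<close> excludes them.\<close>

definition basis :: "nat \<times> nat \<Rightarrow> homog" where
  "basis p = (if fst p = 0 then V else if fst p = 1 then F else W) (snd p)"

abbreviation "basis_product ps \<equiv> triangle (map basis ps)"

lemmas triangle_Cons = cmul_triangle[symmetric]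

lemma triangle_move: "\<exists>s. triangle (A # u @ v) = s *\<^sub>R triangle (u @ A # v)"
proof (induction u)
  case Nil
  show ?case by (intro exI[of _ 1]) simp
next
  case (Cons B u)
  then obtain s where s: "triangle (A # u @ v) = s *\<^sub>R triangle (u @ A # v)" by blast
  have "triangle (A # (B # u) @ v) = - ((- 1) ^ (deg A * deg B) *\<^sub>R cmul B (triangle (A # u @ v)))"
    by (simp add: triangle_Cons cmul_commute[of A B])
  also have "\<dots> = (- ((- 1) ^ (deg A * deg B)) * s) *\<^sub>R triangle ((B # u) @ A # v)"
    using s by (simp add: triangle_Cons)
  finally show ?case by blast
qed

text \<open>Reordering only changes the sign. An unspecified scalar is enough here, since the lemma
  serves to compare spans and to detect vanishing.\<close>

lemma triangle_mset_eq:
  assumes "mset L = mset L'"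
  shows "\<exists>s. triangle L = s *\<^sub>R triangle L'"
  using assms
proof (induction L arbitrary: L')
  case Nil
  then show ?case by (intro exI[of _ 1]) simp
next
  case (Cons A L)
  then have "A \<in> set L'" by (metis list.set_intros(1) mset_eq_setD)
  then obtain u v where L': "L' = u @ A # v" by (metis split_list)
  then have "mset L = mset (u @ v)" using Cons.prems by simp
  then obtain s where s: "triangle L = s *\<^sub>R triangle (u @ v)" using Cons.IH by blast
  obtain t where t: "triangle (A # u @ v) = t *\<^sub>R triangle (u @ A # v)"
    using triangle_move by blast
  have "triangle (A # L) = (s * t) *\<^sub>R triangle L'"
    using t by (simp add: triangle_Cons s L')
  then show ?case by blast
qed

lemma basis_product_mset_eq: "mset ps = mset qs \<Longrightarrow> \<exists>s. basis_product ps = s *\<^sub>R basis_product qs"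
  by (rule triangle_mset_eq) simp

text \<open>Two equal vector fields can be brought to the front, where skew-symmetry makes the
  product its own negative.\<close>

lemma basis_product_repeated_vector_field:
  assumes "count (mset ps) (0, j) > 1"
  shows "basis_product ps = 0"
proof -
  have "replicate_mset 2 (0, j) \<subseteq># mset ps"
    using assms by (simp add: count_le_replicate_mset_subset_eq[symmetric])
  then obtain N where N: "mset ps = replicate_mset 2 (0, j) + N"
    by (metis subset_mset.le_iff_add)
  obtain qs where "N = mset qs" by (metis ex_mset)
  with N have "mset ps = mset ((0, j) # (0, j) # qs)"
    by (simp add: numeral_2_eq_2)
  then obtain s where "basis_product ps = s *\<^sub>R basis_product ((0, j) # (0, j) # qs)"
    using basis_product_mset_eq by blast
  then show ?thesis
    by (simp add: triangle_Cons cmul_self_even basis_def)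
qed

lemma basis_gpart: "fst p \<le> 2 \<Longrightarrow> basis p \<in> gpart (fst p) (snd p)"
  by (auto simp: basis_def gpart_def V_def F_def W_def intro!: exI[of _ 1])

lemma gpart_basis:
  assumes "A \<in> gpart i j"
  shows "i \<le> 2" "\<exists>c. \<forall>x. cmul A x = c *\<^sub>R cmul (basis (i, j)) x"
proof -
  obtain c where c: "A \<in> {VField (monom c j), Func (monom c j), OneForm (monom c j)}"
    and i: "deg A = i"
    using assms by (auto simp: gpart_def)
  then show "i \<le> 2" by auto
  have "monom c j = smult c (monom 1 j)" by (simp add: smult_monom)
  then have "cmul A x = c *\<^sub>R cmul (basis (i, j)) x" for x
    using c i by (auto simp: basis_def V_def F_def W_def cmul_smult)
  then show "\<exists>c. \<forall>x. cmul A x = c *\<^sub>R cmul (basis (i, j)) x" by blast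
qed

lemma triangle_gpart:
  assumes "list_all2 (\<lambda>A p. A \<in> gpart (fst p) (snd p)) As ps"
  shows "\<exists>c. triangle As = c *\<^sub>R basis_product ps"
  using assms
proof (induction rule: list_all2_induct)
  case Nil
  show ?case by (intro exI[of _ 1]) simp
next
  case (Cons A As p ps)
  then obtain c where "triangle As = c *\<^sub>R basis_product ps" by blast
  moreover obtain b where "\<forall>x. cmul A x = b *\<^sub>R cmul (basis p) x"
    using gpart_basis(2)[OF Cons(1)] by auto
  ultimately have "triangle (A # As) = (c * b) *\<^sub>R basis_product (p # ps)"
    by (simp add: triangle_Cons)
  then show ?case by blast
qed

definition weighted :: "nat \<Rightarrow> nat \<Rightarrow> int \<Rightarrow> (nat \<times> nat) list \<Rightarrow> bool" where
  "weighted m w h ps \<longleftrightarrow> length ps = m \<and> (\<forall>p\<in>set ps. fst p \<le> 2) \<and>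
     sum_list (map fst ps) = w \<and> int (sum_list (map snd ps)) - int m = h"

lemma chain_space_eq_span_basis_product: "chain_space m w h = span (basis_product ` {ps. weighted m w h ps})"
proof (rule antisym)
  show "chain_space m w h \<subseteq> span (basis_product ` {ps. weighted m w h ps})"
    unfolding chain_space_def
  proof (rule span_minimal[OF _ subspace_span], rule subsetI)
    fix x assume "x \<in> {triangle As | As is js.
      length As = m \<and> length is = m \<and> length js = m \<and>
      (\<forall>s<m. As ! s \<in> gpart (is ! s) (js ! s)) \<and>
      sum_list is = w \<and> int (sum_list js) - int m = h}"
    then obtain As "is" js where x: "x = triangle As" and l: "length As = m" "length is = m" "length js = m"
      and g: "\<And>s. s < m \<Longrightarrow> As ! s \<in> gpart (is ! s) (js ! s)"
      and w: "sum_list is = w" "int (sum_list js) - int m = h"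
      by blast
    have "list_all2 (\<lambda>A p. A \<in> gpart (fst p) (snd p)) As (zip is js)"
      using l g by (auto simp: list_all2_conv_all_nth)
    then obtain c where "x = c *\<^sub>R basis_product (zip is js)"
      using triangle_gpart x by blast
    moreover have "weighted m w h (zip is js)"
      using l w g gpart_basis(1) by (auto simp: weighted_def set_zip)
    ultimately show "x \<in> span (basis_product ` {ps. weighted m w h ps})"
      by (auto intro: span_scale span_base)
  qed
  show "span (basis_product ` {ps. weighted m w h ps}) \<subseteq> chain_space m w h"
    unfolding chain_space_def
  proof (rule span_mono, rule image_subsetI)
    fix ps assume "ps \<in> {ps. weighted m w h ps}"
    then show "basis_product ps \<in> {triangle As | As is js.
      length As = m \<and> length is = m \<and> length js = m \<and>
      (\<forall>s<m. As ! s \<in> gpart (is ! s) (js ! s)) \<and>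
      sum_list is = w \<and> int (sum_list js) - int m = h}"
      unfolding weighted_def mem_Collect_eq
      by (intro exI[of _ "map basis ps"] exI[of _ "map fst ps"] exI[of _ "map snd ps"])
         (simp add: basis_gpart)
  qed
qed

section \<open>Classification of nonzero products by excess\<close>

definition excess :: "nat \<times> nat \<Rightarrow> int" where
  "excess p = int (fst p) + int (snd p) - 1"

lemma excess_nonneg: "p \<noteq> (0, 0) \<Longrightarrow> excess p \<ge> 0"
  by (cases p) (auto simp: excess_def)

lemma excess_eq_0: "excess p = 0 \<longleftrightarrow> p \<in> {(0, 1), (1, 0)}"
  by (cases p) (auto simp: excess_def)

lemma excess_eq_1: "excess p = 1 \<longleftrightarrow> p \<in> {(0, 2), (1, 1), (2, 0)}"
  by (cases p) (auto simp: excess_def)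

lemma sum_excess_nonneg: "(0, 0) \<notin># M \<Longrightarrow> (\<Sum>p\<in>#M. excess p) \<ge> 0"
  by (induction M) (auto intro!: add_nonneg_nonneg excess_nonneg)

lemma sum_excess_0:
  assumes "(0, 0) \<notin># M" "(\<Sum>p\<in>#M. excess p) = 0"
  shows "\<exists>a b. M = replicate_mset a (0, 1) + replicate_mset b (1, 0)"
  using assms
proof (induction M)
  case empty
  show ?case by (intro exI[of _ 0]) simp
next
  case (add x M)
  then have "excess x = 0 \<and> (\<Sum>p\<in>#M. excess p) = 0"
    using excess_nonneg[of x] sum_excess_nonneg[of M] by fastforce
  then obtain a b where M: "M = replicate_mset a (0, 1) + replicate_mset b (1, 0)"
    and x: "x \<in> {(0, 1), (1, 0)}"
    using add excess_eq_0 by auto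
  then have "add_mset x M = replicate_mset (Suc a) (0, 1) + replicate_mset b (1, 0) \<or>
      add_mset x M = replicate_mset a (0, 1) + replicate_mset (Suc b) (1, 0)"
    by auto
  then show ?case by blast
qed

text \<open>With nonnegative integer summands, exactly one is 1 and the rest are 0.\<close>

lemma sum_excess_1:
  assumes "(0, 0) \<notin># M" "(\<Sum>p\<in>#M. excess p) = 1"
  shows "\<exists>y\<in>{(0, 2), (1, 1), (2, 0)}. \<exists>a b.
    M = add_mset y (replicate_mset a (0, 1) + replicate_mset b (1, 0))"
  using assms
proof (induction M)
  case (add x M)
  then consider "excess x = 1" "(\<Sum>p\<in>#M. excess p) = 0" | "excess x = 0" "(\<Sum>p\<in>#M. excess p) = 1"
    using excess_nonneg[of x] sum_excess_nonneg[of M] by fastforce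
  then show ?case
  proof cases
    case 1
    then show ?thesis
      using sum_excess_0[of M] add.prems(1) excess_eq_1[of x] by auto
  next
    case 2
    then obtain y a b where y: "y \<in> {(0, 2), (1, 1), (2, 0)}"
      and M: "M = add_mset y (replicate_mset a (0, 1) + replicate_mset b (1, 0))"
      and x: "x \<in> {(0, 1), (1, 0)}"
      using add excess_eq_0 by auto
    then have "add_mset x M = add_mset y (replicate_mset (Suc a) (0, 1) + replicate_mset b (1, 0)) \<or>
        add_mset x M = add_mset y (replicate_mset a (0, 1) + replicate_mset (Suc b) (1, 0))"
      by auto
    then show ?thesis using y by blast
  qed
qed simp

text \<open>One ordering is fixed for each possible multiset of factors: \<open>a\<close> counts
  \<open>V 1\<close>, and \<open>y\<close> is the factor of excess 1 that accompanies
  \<open>V 0\<close>. The primary weight determines the number of constants, and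
  \<open>fst y \<le> w\<close> keeps the truncated subtraction exact.\<close>

definition canonical :: "nat \<Rightarrow> nat \<Rightarrow> (nat \<times> nat) list set" where
  "canonical m w = {qs. \<exists>a\<in>{0, 1}.
     (a + w = m \<and> qs = replicate a (0, 1) @ replicate w (1, 0)) \<or>
     (\<exists>y\<in>{(0, 2), (1, 1), (2, 0)}. fst y \<le> w \<and> a + (w - fst y) + 2 = m \<and>
        qs = (0, 0) # replicate a (0, 1) @ y # replicate (w - fst y) (1, 0))}"

lemma canonical_weighted: "ps \<in> canonical m w \<Longrightarrow> weighted m w (- int w) ps"
  by (auto simp: canonical_def weighted_def sum_list_replicate)

lemma weighted_canonical:
  assumes "weighted m w (- int w) ps" "basis_product ps \<noteq> 0"
  shows "\<exists>qs\<in>canonical m w. mset ps = mset qs"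
proof -
  have le1: "count (mset ps) (0, j) \<le> 1" for j
    using basis_product_repeated_vector_field[of ps j] assms(2) by fastforce
  have sum_excess: "(\<Sum>p\<in>#mset ps. excess p) =
      int (sum_list (map fst ps)) + int (sum_list (map snd ps)) - int (length ps)"
    by (induction ps) (auto simp: excess_def)
  \<comment> \<open>The total excess is primary plus secondary weight, here w + (-w).\<close>
  have total: "(\<Sum>p\<in>#mset ps. excess p) = 0"
    unfolding sum_excess using assms(1) by (simp add: weighted_def)
  have len: "size (mset ps) = m" and wt: "(\<Sum>p\<in>#mset ps. fst p) = w"
    using assms(1) by (simp_all add: weighted_def sum_mset_sum_list flip: mset_map)
  show ?thesis
  proof (cases "(0, 0) \<in># mset ps")
    case False
    then obtain a b where M: "mset ps = replicate_mset a (0, 1) + replicate_mset b (1, 0)"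
      using sum_excess_0 total by blast
    have "a \<in> {0, 1}" using le1[of 1] by (auto simp: M)
    moreover have "a + b = m" "b = w" using len wt by (simp_all add: M)
    ultimately have "replicate a (0, 1) @ replicate b (1, 0) \<in> canonical m w"
      unfolding canonical_def by blast
    then show ?thesis by (rule bexI[rotated]) (simp add: M)
  next
    case True
    then obtain N where N: "mset ps = add_mset (0, 0) N" by (metis insert_DiffM)
    then have "(0, 0) \<notin># N" using le1[of 0] by (simp add: not_in_iff)
    \<comment> \<open>The removed factor \<open>V 0\<close> has excess -1.\<close>
    moreover have "(\<Sum>p\<in>#N. excess p) = 1" using total by (simp add: N excess_def)
    ultimately obtain y a b where y: "y \<in> {(0, 2), (1, 1), (2, 0)}"
      and M: "N = add_mset y (replicate_mset a (0, 1) + replicate_mset b (1, 0))"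
      using sum_excess_1 by blast
    have "a \<in> {0, 1}" using le1[of 1] by (auto simp: N M split: if_splits)
    moreover have "fst y \<le> w" "b = w - fst y" "a + b + 2 = m" using len wt by (auto simp: N M)
    ultimately have "(0, 0) # replicate a (0, 1) @ y # replicate b (1, 0) \<in> canonical m w"
      unfolding canonical_def using y by blast
    then show ?thesis by (rule bexI[rotated]) (simp add: M N)
  qed
qed

lemma chain_space_eq_span_canonical: "chain_space m w (- int w) = span (basis_product ` canonical m w)"
  unfolding chain_space_eq_span_basis_product
proof (rule antisym)
  show "span (basis_product ` {ps. weighted m w (- int w) ps}) \<subseteq> span (basis_product ` canonical m w)"
  proof (rule span_minimal[OF _ subspace_span], rule image_subsetI)
    fix ps assume "ps \<in> {ps. weighted m w (- int w) ps}"
    then consider "basis_product ps = 0" | qs where "qs \<in> canonical m w" "mset ps = mset qs"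
      using weighted_canonical by blast
    then show "basis_product ps \<in> span (basis_product ` canonical m w)"
    proof cases
      case 1
      then show ?thesis by (simp add: span_zero)
    next
      case 2
      then obtain s where "basis_product ps = s *\<^sub>R basis_product qs" using basis_product_mset_eq by blast
      then show ?thesis using 2(1) by (auto intro: span_scale span_base)
    qed
  qed
  show "span (basis_product ` canonical m w) \<subseteq> span (basis_product ` {ps. weighted m w (- int w) ps})"
    by (intro span_mono image_mono) (auto dest: canonical_weighted)
qed

lemma boundary_chain_space:
  "boundary ` chain_space m w (- int w) = span (boundary ` basis_product ` canonical m w)"
  by (simp add: chain_space_eq_span_canonical linear_span_image linear_boundary)

section \<open>Explicit generators and ranks\<close>

lemma basis_product_ones: "basis_product (replicate n (1, 0)) = ones n"
  by (simp add: ones_def basis_def map_replicate F_def)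

text \<open>For m = w + k + 1 the products without \<open>V 0\<close> need a = k + 1, and those with
  \<open>V 0\<close> need a = \<open>fst y\<close> + k - 1. As a is 0 or 1, few cases survive;
  writing w = n + 2 ensures \<open>fst y \<le> w\<close>.\<close>

lemma canonical_values:
  "canonical (n + 3) (n + 2) = {(0, 1) # replicate (n + 2) (1, 0),
     (0, 0) # (1, 1) # replicate (n + 1) (1, 0), (0, 0) # (0, 1) # (2, 0) # replicate n (1, 0)}"
  "canonical (n + 4) (n + 2) = {(0, 0) # (0, 2) # replicate (n + 2) (1, 0),
     (0, 0) # (0, 1) # (1, 1) # replicate (n + 1) (1, 0)}"
  "canonical (n + 5) (n + 2) = {(0, 0) # (0, 1) # (0, 2) # replicate (n + 2) (1, 0)}"
  "canonical (n + 6) (n + 2) = {}"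
proof -
  have replicate_1: "replicate 1 x = [x]" for x :: 'a
    by (simp add: One_nat_def)
  show "canonical (n + 3) (n + 2) = {(0, 1) # replicate (n + 2) (1, 0),
     (0, 0) # (1, 1) # replicate (n + 1) (1, 0), (0, 0) # (0, 1) # (2, 0) # replicate n (1, 0)}"
    "canonical (n + 4) (n + 2) = {(0, 0) # (0, 2) # replicate (n + 2) (1, 0),
     (0, 0) # (0, 1) # (1, 1) # replicate (n + 1) (1, 0)}"
    "canonical (n + 5) (n + 2) = {(0, 0) # (0, 1) # (0, 2) # replicate (n + 2) (1, 0)}"
    "canonical (n + 6) (n + 2) = {}"
    unfolding canonical_def by (auto simp: replicate_1 simp del: replicate_Suc add_2_eq_Suc')
qed

lemma basis_eq: "basis (0, j) = V j" "basis (1, j) = F j" "basis (2, j) = W j"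
  by (simp_all add: basis_def)

lemma boundary_V_F_ones_nonzero: "boundary (cmul (V 0) (cmul (F 1) (ones (n + 1)))) \<noteq> 0"
proof
  assume "boundary (cmul (V 0) (cmul (F 1) (ones (n + 1)))) = 0"
  then have "contract 0 0 (boundary (cmul (V 0) (cmul (F 1) (ones (Suc n))))) = 0"
    by (simp only: Suc_eq_plus1 linear_0[OF linear_contract])
  then show False
    unfolding boundary_V_F_ones by (simp add: contract_cmul contract_ones_0 W_ones_nonzero)
qed

text \<open>Contraction with the dual of \<open>V 0\<close> kills \<open>x\<close>, a multiple of
  \<open>V 1\<close> times constants, but not \<open>y\<close>, which has a term containing
  \<open>V 0\<close>. So \<open>y\<close> is no multiple of the nonzero \<open>x\<close>.\<close>

lemma boundary_V_V_independent:
  assumes x: "x = boundary (cmul (V 0) (cmul (V 2) (ones (n + 2))))"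
    and y: "y = boundary (cmul (V 0) (cmul (V 1) (cmul (F 1) (ones (n + 1)))))"
  shows "independent {x, y}" "x \<noteq> y"
proof -
  have x': "contract 0 0 x = 0"
    unfolding x boundary_V_V_ones by (simp add: contract_cmul contract_ones_0)
  have "contract 0 0 y \<noteq> 0"
    using V_W_ones_nonzero[of n] unfolding y Suc_eq_plus1[symmetric] boundary_V_V_F_ones
    by (simp add: contract_cmul contract_ones_0)
  then have "y \<noteq> c *\<^sub>R x" for c
    using x' by auto
  then have "y \<notin> span {x}" by (auto simp: span_singleton)
  moreover have "x \<noteq> 0"
    unfolding x boundary_V_V_ones by (simp add: V_ones_nonzero)
  ultimately show "independent {x, y}"
    by (subst insert_commute) (auto simp: independent_insert)
  show "x \<noteq> y" using \<open>y \<notin> span {x}\<close> by (auto intro: span_base)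
qed

lemma rank_values:
  "rank_on boundary (chain_space (n + 3) (n + 2) (- int (n + 2))) = 1"
  "rank_on boundary (chain_space (n + 4) (n + 2) (- int (n + 2))) = 2"
  "rank_on boundary (chain_space (n + 5) (n + 2) (- int (n + 2))) = 0"
  "rank_on boundary (chain_space (n + 6) (n + 2) (- int (n + 2))) = 0"
proof -
  note simps = rank_on_def boundary_chain_space canonical_values image_insert image_empty
    list.map basis_product_ones triangle_Cons basis_eq boundary_V_ones boundary_V_V_W_ones
    boundary_V_V_V_ones
  \<comment> \<open>For k = 0 the first and third generators are cycles, so only the boundary of the
    second counts.\<close>
  have "dim (span {0, x, 0}) = 1" if "x \<noteq> 0" for x :: chain
  proof -
    have "span {0, x, 0} = span {x}"
      by (metis insert_commute insert_absorb2 span_insert_0)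
    then show ?thesis using that by (simp add: dim_eq_card_independent)
  qed
  then show "rank_on boundary (chain_space (n + 3) (n + 2) (- int (n + 2))) = 1"
    unfolding simps using boundary_V_F_ones_nonzero by blast
  show "rank_on boundary (chain_space (n + 4) (n + 2) (- int (n + 2))) = 2"
    unfolding simps using boundary_V_V_independent[OF refl refl, of n]
    by (simp add: dim_eq_card_independent)
  show "rank_on boundary (chain_space (n + 5) (n + 2) (- int (n + 2))) = 0"
    unfolding simps using span_insert_0[of "{}"]
    by (metis dim_span dim_eq_card_independent independent_empty card.empty)
  show "rank_on boundary (chain_space (n + 6) (n + 2) (- int (n + 2))) = 0"
    unfolding simps by (metis dim_span dim_eq_card_independent independent_empty card.empty)
qed

theorem corollary1:
  fixes w k :: nat
  assumes "w > 2" and "k \<in> {0, 1, 2, 3}"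
  shows "rank_on boundary (chain_space (w + k + 1) w (- int w)) =
         rank_on boundary (chain_space (2 + k + 1) 2 (- 2))"
proof -
  \<comment> \<open>The value depends on \<open>k\<close> alone, so the two sides of the claim are
    the instances for w = n + 2 and for n = 0.\<close>
  have rank: "rank_on boundary (chain_space (n + 2 + k + 1) (n + 2) (- int (n + 2))) =
      (if k = 0 then 1 else if k = 1 then 2 else 0)" for n
  proof -
    have "n + 2 + k + 1 = n + (k + 3)" by simp
    then show ?thesis
      using assms(2) rank_values[of n] by (auto simp: add.commute[of _ n] simp del: of_nat_add add_2_eq_Suc')
  qed
  obtain n where "w = n + 2"
    using assms(1) by (metis add.commute less_imp_add_positive)
  then show ?thesis
    using trans[OF rank[of n] rank[of 0, symmetric]] by (simp only: add_0 of_nat_numeral)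
qed

end
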